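(* Let $X$ be a real Hilbert space, let $T\colon X\to X$ be firmly nonexpansive, let $A\colon X\rightrightarrows X$ be maximally monotone, and suppose that $T=J_A$, or equivalently that $A=T^{-1}-\mathrm{Id}$. For a mapping $S\colon X\to X$ consider the properties $$(a)\quad(\forall x\in X)(\forall y\in X)\quad Sx\neq Sy\;\Rightarrow\;\|Sx-Sy\|^2<\langle x-y,Sx-Sy\rangle,$$ $$(b)\quad(\forall x\in X)(\forall y\in X)\quad(\mathrm{Id}-S)x\neq(\mathrm{Id}-S)y\;\Rightarrow\;\|Sx-Sy\|^2<\langle x-y,Sx-Sy\rangle,$$ and for an operator $B\colon X\rightrightarrows X$ consider the property $$(c)\quad(\forall(x,u)\in\operatorname{gr}B)(\forall(y,v)\in\operatorname{gr}B)\quad u\neq v\;\Rightarrow\;\langle x-y,u-v\rangle>0.$$ Then the following are equivalent: (i) $S=T$ satisfies (a). (ii) $A$ is strictly monotone. (iii) $S=\mathrm{Id}-T$ satisfies (b). (iv) $B=A^{-1}$ satisfies (c). Thus, for firmly nonexpansive mappings, properties (a) and (b) are dual to each other; and correspondingly, for maximally monotone operators, strict monotonicity and property (c) are dual to each other. These properties are not self-dual: e.g., $T=0$ trivially satisfies (a), but $\mathrm{Id}-0=\mathrm{Id}$ does not.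
   Context: $X$ is a real Hilbert space; $\mathrm{Id}$ is the identity on $X$. $T\colon X\to X$ is firmly nonexpansive if $\|Tx-Ty\|^2+\|(\mathrm{Id}-T)x-(\mathrm{Id}-T)y\|^2\leq\|x-y\|^2$ for all $x,y\in X$. For $A\colon X\rightrightarrows X$ (so $Ax\subseteq X$ for each $x$): $\operatorname{gr}A=\{(x,u):u\in Ax\}$ and $x\in A^{-1}u\Leftrightarrow u\in Ax$. $A$ is monotone if $\langle x-y,u-v\rangle\geq0$ for all $(x,u),(y,v)\in\operatorname{gr}A$, strictly monotone if $\langle x-y,u-v\rangle>0$ whenever $(x,u),(y,v)\in\operatorname{gr}A$ and $x\neq y$, and maximally monotone if it is monotone with no proper monotone extension. The resolvent of a maximally monotone $A$ is $J_A=(\mathrm{Id}+A)^{-1}\colon X\to X$. Properties $(p),(p^* )$ of firmly nonexpansive mappings on $X$ are dual to each other if, for every firmly nonexpansive $T\colon X\to X$, $T$ satisfies $(p)$ if and only if $\mathrm{Id}-T$ satisfies $(p^* )$. Properties $(q),(q^* )$ of maximally monotone operators on $X$ are dual to each other if, for every maximally monotone $A\colon X\rightrightarrows X$, $A$ satisfies $(q)$ if and only if $A^{-1}$ satisfies $(q^* )$. A property is self-dual if it is dual to itself.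
   Formalization: The claims that the properties are not self-dual and that Id does not satisfy (a) are stated for X ≠ {0}; for X = {0} all four properties hold vacuously and are self-dual, so those claims fail there. *)

theory Defs
  imports "HOL-Analysis.Analysis"
begin

text \<open>A set-valued operator on \<open>X\<close> is a function of type \<open>'a \<Rightarrow> 'a set\<close>. A map
  \<open>T\<close> from \<open>X\<close> to \<open>X\<close> is regarded as the operator whose value at \<open>x\<close> is
  the singleton \<open>{T x}\<close>.\<close>

definition op_of :: "('a \<Rightarrow> 'a) \<Rightarrow> 'a \<Rightarrow> 'a set" where
  "op_of T = (\<lambda>x. {T x})"

definition gr :: "('a \<Rightarrow> 'a set) \<Rightarrow> ('a \<times> 'a) set" where
  "gr A = {(x, u). u \<in> A x}"

definition op_inverse :: "('a \<Rightarrow> 'a set) \<Rightarrow> 'a \<Rightarrow> 'a set" where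
  "op_inverse A = (\<lambda>u. {x. u \<in> A x})"

definition op_plus :: "('a::plus \<Rightarrow> 'a set) \<Rightarrow> ('a \<Rightarrow> 'a set) \<Rightarrow> 'a \<Rightarrow> 'a set" where
  "op_plus A B = (\<lambda>x. {u + v |u v. u \<in> A x \<and> v \<in> B x})"

definition op_minus :: "('a::minus \<Rightarrow> 'a set) \<Rightarrow> ('a \<Rightarrow> 'a set) \<Rightarrow> 'a \<Rightarrow> 'a set" where
  "op_minus A B = (\<lambda>x. {u - v |u v. u \<in> A x \<and> v \<in> B x})"

definition firmly_nonexpansive :: "('a::real_inner \<Rightarrow> 'a) \<Rightarrow> bool" where
  "firmly_nonexpansive T \<longleftrightarrow>
    (\<forall>x y. (norm (T x - T y))\<^sup>2 + (norm ((x - T x) - (y - T y)))\<^sup>2 \<le> (norm (x - y))\<^sup>2)"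

definition monotone_op :: "('a::real_inner \<Rightarrow> 'a set) \<Rightarrow> bool" where
  "monotone_op A \<longleftrightarrow> (\<forall>(x, u) \<in> gr A. \<forall>(y, v) \<in> gr A. (x - y) \<bullet> (u - v) \<ge> 0)"

definition strictly_monotone_op :: "('a::real_inner \<Rightarrow> 'a set) \<Rightarrow> bool" where
  "strictly_monotone_op A \<longleftrightarrow>
    (\<forall>(x, u) \<in> gr A. \<forall>(y, v) \<in> gr A. x \<noteq> y \<longrightarrow> (x - y) \<bullet> (u - v) > 0)"

definition maximally_monotone :: "('a::real_inner \<Rightarrow> 'a set) \<Rightarrow> bool" where
  "maximally_monotone A \<longleftrightarrow>
    monotone_op A \<and> \<not> (\<exists>B. monotone_op B \<and> gr A \<subset> gr B)"

text \<open>The resolvent is formed as a set-valued operator. For maximally monotone \<open>A\<close> it is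
  everywhere defined and single-valued (Minty), so that the equation between the map \<open>T\<close> and
  the resolvent of \<open>A\<close> reads \<open>op_of T = resolvent A\<close>.\<close>

definition resolvent :: "('a::real_inner \<Rightarrow> 'a set) \<Rightarrow> 'a \<Rightarrow> 'a set" where
  "resolvent A = op_inverse (op_plus (op_of id) A)"

definition id_minus :: "('a::minus \<Rightarrow> 'a) \<Rightarrow> 'a \<Rightarrow> 'a" where
  "id_minus T = (\<lambda>x. x - T x)"

definition property_a :: "('a::real_inner \<Rightarrow> 'a) \<Rightarrow> bool" where
  "property_a S \<longleftrightarrow>
    (\<forall>x y. S x \<noteq> S y \<longrightarrow> (norm (S x - S y))\<^sup>2 < (x - y) \<bullet> (S x - S y))"

definition property_b :: "('a::real_inner \<Rightarrow> 'a) \<Rightarrow> bool" where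
  "property_b S \<longleftrightarrow>
    (\<forall>x y. id_minus S x \<noteq> id_minus S y \<longrightarrow>
      (norm (S x - S y))\<^sup>2 < (x - y) \<bullet> (S x - S y))"

definition property_c :: "('a::real_inner \<Rightarrow> 'a set) \<Rightarrow> bool" where
  "property_c B \<longleftrightarrow>
    (\<forall>(x, u) \<in> gr B. \<forall>(y, v) \<in> gr B. u \<noteq> v \<longrightarrow> (x - y) \<bullet> (u - v) > 0)"

definition dual_firmly_nonexpansive ::
    "(('a::real_inner \<Rightarrow> 'a) \<Rightarrow> bool) \<Rightarrow> (('a \<Rightarrow> 'a) \<Rightarrow> bool) \<Rightarrow> bool" where
  "dual_firmly_nonexpansive p p' \<longleftrightarrow>
    (\<forall>T. firmly_nonexpansive T \<longrightarrow> (p T \<longleftrightarrow> p' (id_minus T)))"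

definition dual_maximally_monotone ::
    "(('a::real_inner \<Rightarrow> 'a set) \<Rightarrow> bool) \<Rightarrow> (('a \<Rightarrow> 'a set) \<Rightarrow> bool) \<Rightarrow> bool" where
  "dual_maximally_monotone q q' \<longleftrightarrow>
    (\<forall>A. maximally_monotone A \<longrightarrow> (q A \<longleftrightarrow> q' (op_inverse A)))"

definition self_dual_firmly_nonexpansive :: "(('a::real_inner \<Rightarrow> 'a) \<Rightarrow> bool) \<Rightarrow> bool" where
  "self_dual_firmly_nonexpansive p \<longleftrightarrow> dual_firmly_nonexpansive p p"

definition self_dual_maximally_monotone :: "(('a::real_inner \<Rightarrow> 'a set) \<Rightarrow> bool) \<Rightarrow> bool" where
  "self_dual_maximally_monotone q \<longleftrightarrow> dual_maximally_monotone q q"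

end

theory Submission imports Defs begin

text \<open>If \<open>T = J\<^sub>A\<close>, then \<open>gr A\<close> consists of the pairs \<open>(T x, x - T x)\<close> (Minty parametrization), and
  \<open>\<langle>x - y, T x - T y\<rangle> - \<parallel>T x - T y\<parallel>\<^sup>2 = \<langle>T x - T y, (x - T x) - (y - T y)\<rangle>\<close>. Hence (a) for \<open>T\<close> is strict
  monotonicity read along this parametrization. Passing from \<open>T\<close> to \<open>Id - T\<close>, or from \<open>A\<close> to its inverse,
  swaps the two factors of the inner product. The counterexamples are \<open>T = 0\<close> and \<open>T = Id\<close>, which are
  the resolvents of the normal cone of \<open>{0}\<close> and of the zero operator.\<close>

lemma mem_gr [simp]: "(x, u) \<in> gr A \<longleftrightarrow> u \<in> A x"
  by (simp add: gr_def)

lemma mem_op_inverse [simp]: "x \<in> op_inverse A u \<longleftrightarrow> u \<in> A x"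
  by (simp add: op_inverse_def)

lemma id_minus_id_minus [simp]: "id_minus (id_minus T) = (T :: 'a::ab_group_add \<Rightarrow> 'a)"
  by (simp add: id_minus_def)

text \<open>The substitution \<open>y = x + u\<close> turns the equation into a pointwise condition
  on \<open>gr A\<close>. The equation \<open>A = T^{-1} - Id\<close> reduces to the same condition,
  so the two are compared through it.\<close>

lemma op_of_eq_resolvent_iff:
  fixes A :: "'a::real_inner \<Rightarrow> 'a set"
  shows "op_of T = resolvent A \<longleftrightarrow> (\<forall>x u. u \<in> A x \<longleftrightarrow> T (x + u) = x)"
proof -
  have "x \<in> resolvent A y \<longleftrightarrow> y - x \<in> A x" for x y
    by (force simp: resolvent_def op_plus_def op_of_def)
  then have "op_of T = resolvent A \<longleftrightarrow> (\<forall>x y. x = T y \<longleftrightarrow> y - x \<in> A x)"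
    by (auto simp: op_of_def fun_eq_iff set_eq_iff)
  also have "\<dots> \<longleftrightarrow> (\<forall>x u. u \<in> A x \<longleftrightarrow> T (x + u) = x)"
    by (metis add_diff_cancel_left' add_diff_cancel_right' diff_add_cancel add.commute)
  finally show ?thesis .
qed

lemma eq_inverse_minus_id_iff:
  fixes A :: "'a::real_inner \<Rightarrow> 'a set"
  shows "A = op_minus (op_inverse (op_of T)) (op_of id) \<longleftrightarrow> (\<forall>x u. u \<in> A x \<longleftrightarrow> T (x + u) = x)"
proof -
  have "u \<in> op_minus (op_inverse (op_of T)) (op_of id) x \<longleftrightarrow> T (x + u) = x" for x u
    unfolding op_minus_def mem_Collect_eq mem_op_inverse
    by (auto simp: op_of_def) (metis add_diff_cancel_left')
  then show ?thesis
    by (simp add: fun_eq_iff set_eq_iff)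
qed

text \<open>Replacing \<open>a\<close>, \<open>b\<close> by \<open>x - a\<close>,
  \<open>y - b\<close> only interchanges the two factors on the right, so this form suits both
  \<open>T\<close> and \<open>Id - T\<close>.\<close>

lemma norm_power2_less_inner_iff:
  fixes x y a b :: "'a::real_inner"
  shows "(norm (a - b))\<^sup>2 < (x - y) \<bullet> (a - b) \<longleftrightarrow> 0 < (a - b) \<bullet> ((x - a) - (y - b))"
  by (simp add: power2_norm_eq_inner inner_simps inner_commute algebra_simps)

lemma property_b_id_minus: "property_b (id_minus T) \<longleftrightarrow> property_a T"
  unfolding property_a_def property_b_def id_minus_id_minus norm_power2_less_inner_iff
  by (simp add: id_minus_def inner_commute)

lemma property_c_op_inverse: "property_c (op_inverse A) \<longleftrightarrow> strictly_monotone_op A"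
proof -
  have "gr (op_inverse A) = prod.swap ` gr A"
    by (force simp: gr_def)
  then show ?thesis
    by (simp add: property_c_def strictly_monotone_op_def case_prod_beta inner_commute)
qed

lemma property_a_iff_strictly_monotone_op:
  fixes A :: "'a::real_inner \<Rightarrow> 'a set"
  assumes "op_of T = resolvent A"
  shows "property_a T \<longleftrightarrow> strictly_monotone_op A"
proof -
  have A: "\<And>x u. u \<in> A x \<longleftrightarrow> T (x + u) = x"
    using assms by (simp add: op_of_eq_resolvent_iff)
  \<comment> \<open>A pair \<open>(x, u)\<close> of the graph comes from the parameter
    \<open>x + u\<close>.\<close>
  have "gr A = range (\<lambda>x. (T x, x - T x))"
    by (auto simp: A image_iff) (metis add_diff_cancel_left')
  then show ?thesis
    by (simp add: property_a_def strictly_monotone_op_def norm_power2_less_inner_iff)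
qed

lemma maximally_monotone_zero: "maximally_monotone (op_of (\<lambda>x :: 'a::real_inner. 0 :: 'a))"
  unfolding maximally_monotone_def
proof (intro conjI notI)
  let ?Z = "op_of (\<lambda>x :: 'a. 0 :: 'a)"
  show "monotone_op ?Z"
    by (auto simp: monotone_op_def op_of_def)
  assume "\<exists>B. monotone_op B \<and> gr ?Z \<subset> gr B"
  then obtain B where B: "monotone_op B" "gr ?Z \<subset> gr B"
    by blast
  then obtain x u where u: "u \<in> B x" "u \<noteq> 0"
    by (auto simp: psubset_eq subset_iff set_eq_iff op_of_def)
  \<comment> \<open>Testing \<open>(x, u)\<close> against \<open>(x + u, 0)\<close> makes the inner
    product equal to \<open>- (u \<bullet> u)\<close>, which is negative.\<close>
  have "0 \<in> B (x + u)"
    using B(2) by (auto simp: psubset_eq subset_iff op_of_def)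
  then have "0 \<le> (x - (x + u)) \<bullet> (u - 0)"
    using B(1) u(1) unfolding monotone_op_def by fastforce
  then show False
    using u(2) by (simp flip: not_less)
qed

theorem theorem3p4:
  "(\<forall>(T :: 'a::{real_inner, complete_space} \<Rightarrow> 'a) A.
      firmly_nonexpansive T \<and> maximally_monotone A \<longrightarrow>
        (op_of T = resolvent A \<longleftrightarrow> A = op_minus (op_inverse (op_of T)) (op_of id)) \<and>
        (op_of T = resolvent A \<longrightarrow>
          (property_a T \<longleftrightarrow> strictly_monotone_op A) \<and>
          (strictly_monotone_op A \<longleftrightarrow> property_b (id_minus T)) \<and>
          (property_b (id_minus T) \<longleftrightarrow> property_c (op_inverse A)))) \<and>
   dual_firmly_nonexpansive (property_a :: ('a \<Rightarrow> 'a) \<Rightarrow> bool) property_b \<and>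
   dual_maximally_monotone (strictly_monotone_op :: ('a \<Rightarrow> 'a set) \<Rightarrow> bool) property_c \<and>
   firmly_nonexpansive (\<lambda>x :: 'a. 0 :: 'a) \<and>
   property_a (\<lambda>x :: 'a. 0 :: 'a) \<and>
   id_minus (\<lambda>x :: 'a. 0 :: 'a) = id \<and>
   ((UNIV :: 'a set) \<noteq> {0} \<longrightarrow>
      \<not> property_a (id :: 'a \<Rightarrow> 'a) \<and>
      \<not> self_dual_firmly_nonexpansive (property_a :: ('a \<Rightarrow> 'a) \<Rightarrow> bool) \<and>
      \<not> self_dual_firmly_nonexpansive (property_b :: ('a \<Rightarrow> 'a) \<Rightarrow> bool) \<and>
      \<not> self_dual_maximally_monotone (strictly_monotone_op :: ('a \<Rightarrow> 'a set) \<Rightarrow> bool) \<and>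
      \<not> self_dual_maximally_monotone (property_c :: ('a \<Rightarrow> 'a set) \<Rightarrow> bool))"
proof -
  let ?z = "\<lambda>x :: 'a. 0 :: 'a"
  have id0: "id_minus ?z = id" "id_minus id = ?z"
    by (auto simp: id_minus_def)
  have fz: "firmly_nonexpansive ?z" and az: "property_a ?z"
    by (simp_all add: firmly_nonexpansive_def property_a_def)
  have fid: "firmly_nonexpansive (id :: 'a \<Rightarrow> 'a)"
    by (simp add: firmly_nonexpansive_def)
  have not_self_dual: "\<not> property_a (id :: 'a \<Rightarrow> 'a) \<and>
      \<not> self_dual_firmly_nonexpansive (property_a :: ('a \<Rightarrow> 'a) \<Rightarrow> bool) \<and>
      \<not> self_dual_firmly_nonexpansive (property_b :: ('a \<Rightarrow> 'a) \<Rightarrow> bool) \<and>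
      \<not> self_dual_maximally_monotone (strictly_monotone_op :: ('a \<Rightarrow> 'a set) \<Rightarrow> bool) \<and>
      \<not> self_dual_maximally_monotone (property_c :: ('a \<Rightarrow> 'a set) \<Rightarrow> bool)"
    if nontrivial: "(UNIV :: 'a set) \<noteq> {0}"
  proof -
    obtain e :: 'a where e: "e \<noteq> 0"
      using nontrivial by auto
    \<comment> \<open>For the identity, both sides of (a) equal the squared norm of
      \<open>x - y\<close>, so the strict inequality fails at \<open>e\<close> and
      \<open>0\<close>.\<close>
    have aid: "\<not> property_a (id :: 'a \<Rightarrow> 'a)"
      using e by (auto simp: property_a_def power2_norm_eq_inner)
    have b: "property_b (id :: 'a \<Rightarrow> 'a)" "\<not> property_b ?z"
      using property_b_id_minus[of ?z] property_b_id_minus[of "id :: 'a \<Rightarrow> 'a"] az aid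
      by (simp_all add: id0)
    \<comment> \<open>All values of the zero operator coincide, so (c) is vacuous, whereas the
      distinct points \<open>e\<close> and \<open>0\<close> give inner product zero.\<close>
    have sc: "\<not> strictly_monotone_op (op_of ?z)" "property_c (op_of ?z)"
      using e by (auto simp: strictly_monotone_op_def property_c_def op_of_def gr_def)
    have inv: "op_inverse (op_inverse (op_of ?z)) = op_of ?z"
      by (simp add: op_inverse_def)
    \<comment> \<open>This inverse is the normal cone of \<open>{0}\<close>: all of the space at
      \<open>0\<close>, empty elsewhere.\<close>
    have scinv: "strictly_monotone_op (op_inverse (op_of ?z))" "\<not> property_c (op_inverse (op_of ?z))"
      using sc property_c_op_inverse[of "op_of ?z"] property_c_op_inverse[of "op_inverse (op_of ?z)"]
      by (simp_all add: inv)
    \<comment> \<open>\<open>id_minus\<close> exchanges \<open>?z\<close> and \<open>id\<close>, and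
      each of (a), (b) holds for exactly one of them. The zero operator and its inverse separate the
      operator properties in the same way.\<close>
    show ?thesis
      unfolding self_dual_firmly_nonexpansive_def dual_firmly_nonexpansive_def
        self_dual_maximally_monotone_def dual_maximally_monotone_def
      using aid az b fz fid id0 sc scinv maximally_monotone_zero by metis
  qed
  show ?thesis
    using fz az id0(1) not_self_dual
    \<comment> \<open>Folding the shared pointwise condition back into the resolvent equation yields
      the equivalence of the two equations.\<close>
    by (simp add: eq_inverse_minus_id_iff[folded op_of_eq_resolvent_iff]
        property_a_iff_strictly_monotone_op property_b_id_minus property_c_op_inverse
        dual_firmly_nonexpansive_def dual_maximally_monotone_def)
qed

end
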